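(* Let $d\ge 1$ and let $k_1,\dots,k_d$ be integers such that $k_i\ge 2$ is even for every $i<d$ and $k_d\ge 3$. Let $f$ be the function on $n=2\sum_{i=1}^d k_i$ variables defined in the context. Then $\deg_{\pm}(f)=d$ and $$W(f,d)\ \ge\ 2^{(k_d-2)\prod_{i=1}^{d-1}k_i\ -\ d}.$$
   Context: Boolean functions are maps $\{0,1\}^n\to\{0,1\}$; $\mathrm{sgn}(t)=1$ if $t\ge 0$ and $\mathrm{sgn}(t)=0$ otherwise. A threshold gate for $f$ is an integer-coefficient polynomial $p$ with $f(x)=\mathrm{sgn}(p(x))$ for all $x\in\{0,1\}^n$; its weight is the sum of absolute values of its coefficients. $\deg_{\pm}(f)$ is the minimal degree of a threshold gate for $f$, and for $d\ge\deg_{\pm}(f)$, $W(f,d)$ is the minimal weight of a threshold gate for $f$ of degree at most $d$. The function $f$: the input is $(x^1,\dots,x^d,y^1,\dots,y^d)$ with $x^i=(x^i_1,\dots,x^i_{k_i}),\ y^i=(y^i_1,\dots,y^i_{k_i})\in\{0,1\}^{k_i}$. For a positive integer $k$ and $[k]=\{1,\dots,k\}$, let $<_1$ be the order $1,2,\dots,k$ and $<_0$ the reverse order $k,k-1,\dots,1$ (listed from smallest to largest); let $\mathrm{num}_1(j)=j$ and $\mathrm{num}_0(j)=k-j+1$ be the position of $j$ in these orders. Let $K=[k_1]\times\dots\times[k_d]$. To each $\alpha=(\alpha_1,\dots,\alpha_d)\in K$ associate indices $i_1(\alpha)=1$ and $i_{l+1}(\alpha)=\mathrm{num}_{i_l(\alpha)}(\alpha_l)\bmod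 2$ (computed in $[k_l]$). Order $K$ as follows: for $\alpha\ne\beta$ let $l$ be the least index with $\alpha_l\ne\beta_l$ (then $i_l(\alpha)=i_l(\beta)$); declare $\alpha<\beta$ iff $\alpha_l$ precedes $\beta_l$ in the order $<_{i_l(\alpha)}$ on $[k_l]$. Let $\alpha$ be the largest element of $K$ in this order with $\prod_{i=1}^d(x^i_{\alpha_i}-y^i_{\alpha_i})\ne 0$; then $f(x,y)=\mathrm{sgn}\prod_{i=1}^d(x^i_{\alpha_i}-y^i_{\alpha_i})$. If no such $\alpha$ exists, $f(x,y)=1$. *)

theory Defs
  imports Complex_Main "HOL-Library.Poly_Mapping" "HOL-Library.FuncSet"
begin

section \<open>Threshold gates\<close>

text \<open>
  A polynomial over \<open>\<int>\<close> in variables of type \<open>'v\<close> maps monomials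
  (finitely supported exponent functions) to coefficients, with finite support.
\<close>

type_synonym 'v int_mpoly = "('v \<Rightarrow>\<^sub>0 nat) \<Rightarrow>\<^sub>0 int"

definition mpoly_vars :: "'v int_mpoly \<Rightarrow> 'v set" where
  "mpoly_vars p = (\<Union>m\<in>Poly_Mapping.keys p. Poly_Mapping.keys m)"

definition mpoly_eval :: "'v int_mpoly \<Rightarrow> ('v \<Rightarrow> int) \<Rightarrow> int" where
  "mpoly_eval p z =
     (\<Sum>m\<in>Poly_Mapping.keys p.
        Poly_Mapping.lookup p m * (\<Prod>v\<in>Poly_Mapping.keys m. z v ^ Poly_Mapping.lookup m v))"

definition monom_degree :: "('v \<Rightarrow>\<^sub>0 nat) \<Rightarrow> nat" where
  "monom_degree m = (\<Sum>v\<in>Poly_Mapping.keys m. Poly_Mapping.lookup m v)"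

text \<open>The zero polynomial gets degree 0.\<close>

definition mpoly_degree :: "'v int_mpoly \<Rightarrow> nat" where
  "mpoly_degree p = Max (insert 0 (monom_degree ` Poly_Mapping.keys p))"

definition mpoly_weight :: "'v int_mpoly \<Rightarrow> nat" where
  "mpoly_weight p = (\<Sum>m\<in>Poly_Mapping.keys p. nat \<bar>Poly_Mapping.lookup p m\<bar>)"

text \<open>Unlike the library's \<^const>\<open>sgn\<close>, this is 1 at 0 and 0 on negative arguments.\<close>

definition sgn01 :: "int \<Rightarrow> int" where
  "sgn01 t = (if t \<ge> 0 then 1 else 0)"

definition cube :: "'v set \<Rightarrow> ('v \<Rightarrow> int) set" where
  "cube V = V \<rightarrow>\<^sub>E {0, 1}"

definition threshold_gate :: "'v set \<Rightarrow> (('v \<Rightarrow> int) \<Rightarrow> int) \<Rightarrow> 'v int_mpoly \<Rightarrow> bool" where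
  "threshold_gate V f p \<longleftrightarrow>
     mpoly_vars p \<subseteq> V \<and> (\<forall>z\<in>cube V. f z = sgn01 (mpoly_eval p z))"

definition threshold_degree :: "'v set \<Rightarrow> (('v \<Rightarrow> int) \<Rightarrow> int) \<Rightarrow> nat" where
  "threshold_degree V f = (LEAST m. \<exists>p. threshold_gate V f p \<and> mpoly_degree p = m)"

definition threshold_weight :: "'v set \<Rightarrow> (('v \<Rightarrow> int) \<Rightarrow> int) \<Rightarrow> nat \<Rightarrow> nat" where
  "threshold_weight V f d =
     (LEAST w. \<exists>p. threshold_gate V f p \<and> mpoly_degree p \<le> d \<and> mpoly_weight p = w)"


section \<open>The Boolean function\<close>

text \<open>\<open>X i j\<close> and \<open>Y i j\<close> are the variables \<open>x\<^sup>i\<^sub>j\<close> and \<open>y\<^sup>i\<^sub>j\<close>; indices start at 1.\<close>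

datatype xy_var = X nat nat | Y nat nat

definition xy_vars :: "nat \<Rightarrow> (nat \<Rightarrow> nat) \<Rightarrow> xy_var set" where
  "xy_vars d k = (\<Union>i\<in>{1..d}. X i ` {1..k i} \<union> Y i ` {1..k i})"

text \<open>In the next two definitions \<open>b\<close> is the subscript, 0 or 1, of the order on \<open>{1..n}\<close>.\<close>

definition num :: "nat \<Rightarrow> nat \<Rightarrow> nat \<Rightarrow> nat" where
  "num n b j = (if b = 1 then j else n - j + 1)"

definition precedes :: "nat \<Rightarrow> nat \<Rightarrow> nat \<Rightarrow> bool" where
  "precedes b j j' \<longleftrightarrow> (if b = 1 then j < j' else j' < j)"

definition K :: "nat \<Rightarrow> (nat \<Rightarrow> nat) \<Rightarrow> (nat \<Rightarrow> nat) set" where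
  "K d k = (\<Pi>\<^sub>E i\<in>{1..d}. {1..k i})"

text \<open>\<open>ind k \<alpha> l\<close> is \<open>i\<^sub>l(\<alpha>)\<close> for \<open>l \<ge> 1\<close>; the value at 0 is never used.\<close>

fun ind :: "(nat \<Rightarrow> nat) \<Rightarrow> (nat \<Rightarrow> nat) \<Rightarrow> nat \<Rightarrow> nat" where
  "ind k \<alpha> 0 = 1"
| "ind k \<alpha> (Suc 0) = 1"
| "ind k \<alpha> (Suc (Suc l)) = num (k (Suc l)) (ind k \<alpha> (Suc l)) (\<alpha> (Suc l)) mod 2"

definition K_less :: "nat \<Rightarrow> (nat \<Rightarrow> nat) \<Rightarrow> (nat \<Rightarrow> nat) \<Rightarrow> (nat \<Rightarrow> nat) \<Rightarrow> bool" where
  "K_less d k \<alpha> \<beta> \<longleftrightarrow>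
     (\<exists>l\<in>{1..d}. (\<forall>m\<in>{1..<l}. \<alpha> m = \<beta> m) \<and> \<alpha> l \<noteq> \<beta> l \<and>
                precedes (ind k \<alpha> l) (\<alpha> l) (\<beta> l))"

definition diff_prod :: "nat \<Rightarrow> (xy_var \<Rightarrow> int) \<Rightarrow> (nat \<Rightarrow> nat) \<Rightarrow> int" where
  "diff_prod d z \<alpha> = (\<Prod>i=1..d. z (X i (\<alpha> i)) - z (Y i (\<alpha> i)))"

definition nonvanishing :: "nat \<Rightarrow> (nat \<Rightarrow> nat) \<Rightarrow> (xy_var \<Rightarrow> int) \<Rightarrow> (nat \<Rightarrow> nat) set" where
  "nonvanishing d k z = {\<alpha> \<in> K d k. diff_prod d z \<alpha> \<noteq> 0}"

definition is_largest :: "nat \<Rightarrow> (nat \<Rightarrow> nat) \<Rightarrow> (nat \<Rightarrow> nat) set \<Rightarrow> (nat \<Rightarrow> nat) \<Rightarrow> bool" where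
  "is_largest d k S \<alpha> \<longleftrightarrow> \<alpha> \<in> S \<and> (\<forall>\<beta>\<in>S. \<beta> \<noteq> \<alpha> \<longrightarrow> K_less d k \<beta> \<alpha>)"

definition xy_fun :: "nat \<Rightarrow> (nat \<Rightarrow> nat) \<Rightarrow> (xy_var \<Rightarrow> int) \<Rightarrow> int" where
  "xy_fun d k z =
     (if nonvanishing d k z = {} then 1
      else sgn01 (diff_prod d z (THE \<alpha>. is_largest d k (nonvanishing d k z) \<alpha>)))"


section \<open>Well-definedness\<close>

lemma card_xy_vars: "card (xy_vars d k) = 2 * (\<Sum>i=1..d. k i)"
proof -
  have "card (X i ` {1..k i} \<union> Y i ` {1..k i}) = 2 * k i" for i
    by (subst card_Un_disjoint) (auto simp: card_image inj_on_def)
  then show ?thesis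
    unfolding xy_vars_def
    by (subst card_UN_disjoint) (auto simp: sum_distrib_left)
qed

lemma finite_K: "finite (K d k)"
  by (auto simp: K_def intro: finite_PiE)

lemma ind_cong:
  assumes "\<forall>m\<in>{1..<l}. \<alpha> m = \<beta> m"
  shows "ind k \<alpha> l = ind k \<beta> l"
  using assms by (induction k \<alpha> l rule: ind.induct) auto

lemma K_less_irrefl: "\<not> K_less d k \<alpha> \<alpha>"
  by (simp add: K_less_def)

lemma K_less_trans:
  assumes "K_less d k \<alpha> \<beta>" "K_less d k \<beta> \<gamma>"
  shows "K_less d k \<alpha> \<gamma>"
proof -
  obtain l where l: "l \<in> {1..d}" "\<forall>m\<in>{1..<l}. \<alpha> m = \<beta> m" "\<alpha> l \<noteq> \<beta> l"
      "precedes (ind k \<alpha> l) (\<alpha> l) (\<beta> l)"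
    using assms(1) by (auto simp: K_less_def)
  obtain l' where l': "l' \<in> {1..d}" "\<forall>m\<in>{1..<l'}. \<beta> m = \<gamma> m" "\<beta> l' \<noteq> \<gamma> l'"
      "precedes (ind k \<beta> l') (\<beta> l') (\<gamma> l')"
    using assms(2) by (auto simp: K_less_def)
  have i: "ind k \<alpha> l = ind k \<beta> l" by (rule ind_cong) (rule l(2))
  consider "l < l'" | "l = l'" | "l' < l" by linarith
  then show ?thesis
  proof cases
    case 1
    then have "\<beta> l = \<gamma> l" using l(1) l'(2) by auto
    then show ?thesis
      unfolding K_less_def using 1 l l'(2) by (intro bexI[of _ l]) auto
  next
    case 2
    have p: "precedes (ind k \<alpha> l) (\<alpha> l) (\<gamma> l)"
      using l(4) l'(4) i 2 by (auto simp: precedes_def split: if_splits)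
    then have "\<alpha> l \<noteq> \<gamma> l" by (auto simp: precedes_def split: if_splits)
    then show ?thesis
      unfolding K_less_def using 2 l(1,2) l'(2) p by (intro bexI[of _ l]) auto
  next
    case 3
    then have "\<alpha> l' = \<beta> l'" using l'(1) l(2) by auto
    moreover have "ind k \<alpha> l' = ind k \<beta> l'"
      by (rule ind_cong) (use 3 l(2) in auto)
    ultimately show ?thesis
      unfolding K_less_def using 3 l(2) l' by (intro bexI[of _ l']) auto
  qed
qed

lemma K_less_total:
  assumes "\<alpha> \<in> K d k" "\<beta> \<in> K d k" "\<alpha> \<noteq> \<beta>"
  shows "K_less d k \<alpha> \<beta> \<or> K_less d k \<beta> \<alpha>"
proof -
  define P where "P l \<longleftrightarrow> l \<in> {1..d} \<and> \<alpha> l \<noteq> \<beta> l" for l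
  have "\<exists>l. P l"
  proof (rule ccontr)
    assume "\<nexists>l. P l"
    then have "\<alpha> = \<beta>"
      using assms(1,2) unfolding K_def P_def by (intro PiE_ext) auto
    then show False using assms(3) by simp
  qed
  then have l: "P (Least P)" by (rule LeastI_ex)
  have eq: "\<forall>m\<in>{1..<Least P}. \<alpha> m = \<beta> m"
  proof
    fix m assume m: "m \<in> {1..<Least P}"
    then have "\<not> P m" using not_less_Least[of m P] by simp
    then show "\<alpha> m = \<beta> m" using m l by (simp add: P_def[of m] P_def[of "Least P"])
  qed
  have i: "ind k \<alpha> (Least P) = ind k \<beta> (Least P)" by (rule ind_cong) (rule eq)
  have "precedes (ind k \<alpha> (Least P)) (\<alpha> (Least P)) (\<beta> (Least P)) \<or>
        precedes (ind k \<beta> (Least P)) (\<beta> (Least P)) (\<alpha> (Least P))"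
    using l unfolding i P_def precedes_def by auto
  moreover have "Least P \<in> {1..d}" "\<alpha> (Least P) \<noteq> \<beta> (Least P)"
    using l by (simp_all add: P_def)
  moreover have "\<forall>m\<in>{1..<Least P}. \<beta> m = \<alpha> m" using eq by simp
  ultimately show ?thesis
    unfolding K_less_def using eq by (elim disjE) (blast, metis)
qed

lemma ex1_is_largest:
  assumes "S \<subseteq> K d k" "S \<noteq> {}"
  shows "\<exists>!\<alpha>. is_largest d k S \<alpha>"
proof -
  have "finite S" using assms(1) finite_K by (rule finite_subset)
  then have "\<exists>\<alpha>. is_largest d k S \<alpha>" using assms(2,1)
  proof (induction S rule: finite_ne_induct)
    case (singleton \<alpha>)
    then show ?case by (auto simp: is_largest_def)
  next
    case (insert \<beta> S)
    then obtain \<alpha> where a: "is_largest d k S \<alpha>" by auto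
    then have "K_less d k \<alpha> \<beta> \<or> K_less d k \<beta> \<alpha>"
      using insert.hyps insert.prems by (intro K_less_total) (auto simp: is_largest_def)
    then show ?case
    proof
      assume "K_less d k \<alpha> \<beta>"
      then have "is_largest d k (insert \<beta> S) \<beta>"
        using a unfolding is_largest_def by (metis K_less_trans insert_iff)
      then show ?thesis by blast
    next
      assume "K_less d k \<beta> \<alpha>"
      then have "is_largest d k (insert \<beta> S) \<alpha>"
        using a unfolding is_largest_def by auto
      then show ?thesis by blast
    qed
  qed
  moreover have "\<alpha> = \<beta>" if "is_largest d k S \<alpha>" "is_largest d k S \<beta>" for \<alpha> \<beta>
    using that unfolding is_largest_def by (metis K_less_irrefl K_less_trans)
  ultimately show ?thesis by blast
qed

end

theory Submission
  imports Defs
begin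

text \<open>
  Antisymmetrizing a gate \<open>p\<close> of degree at most \<open>d\<close> under the \<open>d\<close> swaps \<open>x\<^sup>i \<leftrightarrow> y\<^sup>i\<close> kills every
  monomial that misses some block, which leaves a multilinear form \<open>\<Sum>\<^sub>\<alpha> c\<^sub>\<alpha> \<Prod>\<^sub>i (x\<^sup>i - y\<^sup>i)\<^bsub>\<alpha>\<^sub>i\<^esub>\<close>
  (and nothing at all if the degree is below \<open>d\<close>). This form still has the sign of \<open>f\<close>, so \<open>c\<^sub>\<beta>\<close>
  exceeds the sum of any \<open>c\<^sub>\<alpha>\<close> with \<open>\<alpha> < \<beta>\<close> that differ from \<open>\<beta>\<close> in one common coordinate. Along a
  run in the last coordinate the coefficients therefore grow by a factor \<open>2^(k d - 2)\<close>. Consecutive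
  runs are traversed in opposite directions, so the end of one run and the beginning of the next
  differ in a single coordinate and no growth is lost. The largest coefficient is a value of the
  antisymmetrized form, which is a signed sum of \<open>2^d\<close> values of \<open>p\<close> on the cube, hence at most
  \<open>2^d\<close> times the weight.
\<close>

section \<open>Evaluation, degree and weight of polynomials\<close>

definition monom_eval :: "('v \<Rightarrow>\<^sub>0 nat) \<Rightarrow> ('v \<Rightarrow> int) \<Rightarrow> int" where
  "monom_eval m z = (\<Prod>v\<in>Poly_Mapping.keys m. z v ^ Poly_Mapping.lookup m v)"

definition mpoly_var :: "'v \<Rightarrow> 'v int_mpoly" where
  "mpoly_var v = Poly_Mapping.single (Poly_Mapping.single v 1) 1"

lemma mpoly_eval_conv_monom_eval:
  "mpoly_eval p z = (\<Sum>m\<in>Poly_Mapping.keys p. Poly_Mapping.lookup p m * monom_eval m z)"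
  by (simp add: mpoly_eval_def monom_eval_def)

lemma monom_eval_superset:
  assumes "finite S" "Poly_Mapping.keys m \<subseteq> S"
  shows "monom_eval m z = (\<Prod>v\<in>S. z v ^ Poly_Mapping.lookup m v)"
  unfolding monom_eval_def using assms
  by (intro prod.mono_neutral_left) (auto simp: in_keys_iff)

lemma monom_eval_add: "monom_eval (m + n) z = monom_eval m z * monom_eval n z"
proof -
  let ?S = "Poly_Mapping.keys m \<union> Poly_Mapping.keys n"
  have "Poly_Mapping.keys (m + n) \<subseteq> ?S" by (rule Poly_Mapping.keys_add)
  then show ?thesis
    by (simp add: monom_eval_superset[of ?S] lookup_add power_add prod.distrib)
qed

lemma mpoly_eval_single: "mpoly_eval (Poly_Mapping.single m c) z = c * monom_eval m z"
  by (simp add: mpoly_eval_conv_monom_eval)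

lemma mpoly_eval_var: "mpoly_eval (mpoly_var v) z = z v"
  by (simp add: mpoly_var_def mpoly_eval_single monom_eval_def)

lemma mpoly_eval_add: "mpoly_eval (p + q) z = mpoly_eval p z + mpoly_eval q z"
  unfolding mpoly_eval_conv_monom_eval
  by (rule setsum_keys_plus_distrib[where f = "\<lambda>m a. a * monom_eval m z"])
    (simp_all add: distrib_right)

lemma mpoly_eval_diff: "mpoly_eval (p - q) z = mpoly_eval p z - mpoly_eval q z"
  using mpoly_eval_add[of "p - q" q z] by simp

lemma mpoly_eval_sum: "mpoly_eval (\<Sum>i\<in>I. P i) z = (\<Sum>i\<in>I. mpoly_eval (P i) z)"
  by (induction I rule: infinite_finite_induct) (simp_all add: mpoly_eval_add mpoly_eval_def[of 0])

lemma poly_mapping_eq_sum_single: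
  "p = (\<Sum>m\<in>Poly_Mapping.keys p. Poly_Mapping.single m (Poly_Mapping.lookup p m))"
  by (rule poly_mapping_eqI) (auto simp: lookup_sum lookup_single when_def in_keys_iff)

lemma mpoly_eval_mult: "mpoly_eval (p * q) z = mpoly_eval p z * mpoly_eval q z"
proof -
  have "p * q = (\<Sum>m\<in>Poly_Mapping.keys p. \<Sum>n\<in>Poly_Mapping.keys q.
      Poly_Mapping.single (m + n) (Poly_Mapping.lookup p m * Poly_Mapping.lookup q n))"
    by (subst (1) poly_mapping_eq_sum_single[of p], subst (1) poly_mapping_eq_sum_single[of q])
      (simp add: sum_product mult_single)
  then show ?thesis
    by (simp add: mpoly_eval_sum mpoly_eval_single monom_eval_add mpoly_eval_conv_monom_eval[of p]
        mpoly_eval_conv_monom_eval[of q] sum_product mult_ac)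
qed

lemma mpoly_eval_prod: "mpoly_eval (\<Prod>i\<in>I. P i) z = (\<Prod>i\<in>I. mpoly_eval (P i) z)"
proof -
  have "mpoly_eval 1 z = 1" using mpoly_eval_single[of 0 1 z] by (simp add: monom_eval_def)
  then show ?thesis
    by (induction I rule: infinite_finite_induct) (simp_all add: mpoly_eval_mult)
qed

lemma monom_degree_add: "monom_degree (m + n) = monom_degree m + monom_degree n"
  unfolding monom_degree_def by (rule setsum_keys_plus_distrib) simp_all

lemma card_keys_le_monom_degree: "card (Poly_Mapping.keys m) \<le> monom_degree m"
proof -
  have "card (Poly_Mapping.keys m) = (\<Sum>v\<in>Poly_Mapping.keys m. 1)" by simp
  also have "\<dots> \<le> monom_degree m"
    unfolding monom_degree_def by (intro sum_mono) (simp add: in_keys_iff Suc_le_eq)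
  finally show ?thesis .
qed

definition mpolys :: "'v set \<Rightarrow> nat \<Rightarrow> 'v int_mpoly set" where
  "mpolys V D = {p. mpoly_vars p \<subseteq> V \<and> mpoly_degree p \<le> D}"

lemma mpolys_iff:
  "p \<in> mpolys V D \<longleftrightarrow>
    (\<forall>m\<in>Poly_Mapping.keys p. Poly_Mapping.keys m \<subseteq> V \<and> monom_degree m \<le> D)"
  unfolding mpolys_def mpoly_vars_def mpoly_degree_def
  by (subst mem_Collect_eq, subst Max_le_iff) auto

lemma mpolys_const: "Poly_Mapping.single 0 c \<in> mpolys V 0"
  by (simp add: mpolys_iff monom_degree_def)

lemma mpolys_var: "v \<in> V \<Longrightarrow> mpoly_var v \<in> mpolys V 1"
  by (simp add: mpoly_var_def mpolys_iff monom_degree_def)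

lemma mpolys_diff: "p \<in> mpolys V D \<Longrightarrow> q \<in> mpolys V D \<Longrightarrow> p - q \<in> mpolys V D"
  unfolding mpolys_iff using keys_diff[of p q] by blast

lemma mpolys_sum: "(\<And>i. i \<in> I \<Longrightarrow> P i \<in> mpolys V D) \<Longrightarrow> (\<Sum>i\<in>I. P i) \<in> mpolys V D"
  unfolding mpolys_iff using keys_sum[of P I] by blast

lemma mpolys_mult:
  assumes "p \<in> mpolys V D" "q \<in> mpolys V E"
  shows "p * q \<in> mpolys V (D + E)"
  unfolding mpolys_iff
proof
  fix m assume "m \<in> Poly_Mapping.keys (p * q)"
  then obtain a b where m: "m = a + b" and "a \<in> Poly_Mapping.keys p" "b \<in> Poly_Mapping.keys q"
    using Poly_Mapping.keys_mult[of p q] by blast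
  then have "Poly_Mapping.keys a \<subseteq> V" "monom_degree a \<le> D"
    "Poly_Mapping.keys b \<subseteq> V" "monom_degree b \<le> E"
    using assms by (auto simp: mpolys_iff)
  then show "Poly_Mapping.keys m \<subseteq> V \<and> monom_degree m \<le> D + E"
    using Poly_Mapping.keys_add[of a b] unfolding m by (auto simp: monom_degree_add)
qed

lemma mpolys_prod:
  assumes "finite I" "\<And>i. i \<in> I \<Longrightarrow> P i \<in> mpolys V (D i)"
  shows "(\<Prod>i\<in>I. P i) \<in> mpolys V (\<Sum>i\<in>I. D i)"
  using assms
proof (induction I rule: finite_induct)
  case empty
  show ?case using mpolys_const[of 1 V] by simp
next
  case (insert i I)
  then show ?case by (simp add: mpolys_mult)
qed

lemma cube_01: "z \<in> cube V \<Longrightarrow> v \<in> V \<Longrightarrow> z v = 0 \<or> z v = 1"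
  unfolding cube_def by (auto dest: PiE_mem)

lemma monom_eval_cube:
  assumes "z \<in> cube V" "Poly_Mapping.keys m \<subseteq> V"
  shows "monom_eval m z = (\<Prod>v\<in>Poly_Mapping.keys m. z v)"
  unfolding monom_eval_def
proof (rule prod.cong)
  fix v assume v: "v \<in> Poly_Mapping.keys m"
  then have "z v = 0 \<or> z v = 1" using assms by (intro cube_01[OF assms(1)]) auto
  moreover have "Poly_Mapping.lookup m v > 0" using v by (simp add: in_keys_iff)
  ultimately show "z v ^ Poly_Mapping.lookup m v = z v" by auto
qed simp

lemma abs_prod_le_1:
  fixes f :: "'a \<Rightarrow> 'b::linordered_idom"
  assumes "\<And>i. i \<in> A \<Longrightarrow> \<bar>f i\<bar> \<le> 1"
  shows "\<bar>prod f A\<bar> \<le> 1"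
  using assms
  by (induction A rule: infinite_finite_induct) (auto simp: abs_mult intro: mult_le_one)

lemma abs_mpoly_eval_le_weight:
  assumes "z \<in> cube V" "mpoly_vars p \<subseteq> V"
  shows "\<bar>mpoly_eval p z\<bar> \<le> int (mpoly_weight p)"
proof -
  have "\<bar>mpoly_eval p z\<bar> \<le> (\<Sum>m\<in>Poly_Mapping.keys p. \<bar>Poly_Mapping.lookup p m * monom_eval m z\<bar>)"
    unfolding mpoly_eval_conv_monom_eval by (rule sum_abs)
  also have "\<dots> \<le> (\<Sum>m\<in>Poly_Mapping.keys p. \<bar>Poly_Mapping.lookup p m\<bar>)"
  proof (rule sum_mono)
    fix m assume "m \<in> Poly_Mapping.keys p"
    then have V: "Poly_Mapping.keys m \<subseteq> V" using assms(2) by (auto simp: mpoly_vars_def)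
    have "\<bar>monom_eval m z\<bar> \<le> 1"
      unfolding monom_eval_cube[OF assms(1) V]
      using cube_01[OF assms(1)] V by (intro abs_prod_le_1) force
    then show "\<bar>Poly_Mapping.lookup p m * monom_eval m z\<bar> \<le> \<bar>Poly_Mapping.lookup p m\<bar>"
      by (simp add: abs_mult mult_left_le)
  qed
  also have "\<dots> = int (mpoly_weight p)" by (simp add: mpoly_weight_def)
  finally show ?thesis .
qed

lemma threshold_degree_eqI:
  assumes "threshold_gate V f p" "mpoly_degree p \<le> D"
    and "\<And>q. threshold_gate V f q \<Longrightarrow> D \<le> mpoly_degree q"
  shows "threshold_degree V f = D"
  unfolding threshold_degree_def
proof (rule Least_equality)
  show "\<exists>p. threshold_gate V f p \<and> mpoly_degree p = D"
    using assms by (intro exI[of _ p] conjI antisym)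
qed (use assms(3) in blast)

lemma threshold_weight_attained:
  assumes "threshold_gate V f p" "mpoly_degree p \<le> D"
  obtains q where "threshold_gate V f q" "mpoly_degree q \<le> D"
    "mpoly_weight q = threshold_weight V f D"
proof -
  have "\<exists>w q. threshold_gate V f q \<and> mpoly_degree q \<le> D \<and> mpoly_weight q = w"
    using assms by blast
  then have "\<exists>q. threshold_gate V f q \<and> mpoly_degree q \<le> D \<and>
      mpoly_weight q = threshold_weight V f D"
    unfolding threshold_weight_def by (rule LeastI_ex)
  then show thesis using that by blast
qed


section \<open>Antisymmetrization\<close>

fun block :: "xy_var \<Rightarrow> nat" where
  "block (X i j) = i"
| "block (Y i j) = i"

fun index :: "xy_var \<Rightarrow> nat" where
  "index (X i j) = j"
| "index (Y i j) = j"

fun flip :: "xy_var \<Rightarrow> xy_var" where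
  "flip (X i j) = Y i j"
| "flip (Y i j) = X i j"

fun orientation :: "xy_var \<Rightarrow> int" where
  "orientation (X i j) = 1"
| "orientation (Y i j) = -1"

abbreviation block_part :: "xy_var set \<Rightarrow> nat \<Rightarrow> xy_var set" where
  "block_part M i \<equiv> {v \<in> M. block v = i}"

definition swap_blocks :: "nat set \<Rightarrow> xy_var \<Rightarrow> xy_var" where
  "swap_blocks T v = (if block v \<in> T then flip v else v)"

definition antisymmetrize :: "nat \<Rightarrow> ((xy_var \<Rightarrow> int) \<Rightarrow> int) \<Rightarrow> (xy_var \<Rightarrow> int) \<Rightarrow> int" where
  "antisymmetrize d F z = (\<Sum>T\<in>Pow {1..d}. (-1) ^ card T * F (z \<circ> swap_blocks T))"

lemma mem_xy_vars_iff: "v \<in> xy_vars d k \<longleftrightarrow> block v \<in> {1..d} \<and> index v \<in> {1..k (block v)}"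
  by (cases v) (auto simp: xy_vars_def simp del: atLeastAtMost_iff)

lemma mem_K_component: "\<alpha> \<in> K d k \<Longrightarrow> i \<in> {1..d} \<Longrightarrow> \<alpha> i \<in> {1..k i}"
  unfolding K_def by (rule PiE_mem)

lemma mem_K_imp_length_pos: "\<alpha> \<in> K d k \<Longrightarrow> i \<in> {1..d} \<Longrightarrow> 1 \<le> k i"
  using mem_K_component[of \<alpha> d k i] by simp

lemma mem_K_imp_mem_xy_vars:
  assumes "\<alpha> \<in> K d k" "i \<in> {1..d}"
  shows "X i (\<alpha> i) \<in> xy_vars d k" "Y i (\<alpha> i) \<in> xy_vars d k"
  using assms mem_K_component[OF assms] by (simp_all add: mem_xy_vars_iff)

lemma diff_flip:
  fixes z :: "xy_var \<Rightarrow> int"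
  shows "z v - z (flip v) = orientation v * (z (X (block v) (index v)) - z (Y (block v) (index v)))"
  by (cases v) simp_all

lemma swap_blocks_in_xy_vars_iff: "swap_blocks T v \<in> xy_vars d k \<longleftrightarrow> v \<in> xy_vars d k"
  by (cases v) (auto simp: swap_blocks_def mem_xy_vars_iff)

lemma cube_swap_blocks:
  assumes "z \<in> cube (xy_vars d k)"
  shows "z \<circ> swap_blocks T \<in> cube (xy_vars d k)"
  using assms swap_blocks_in_xy_vars_iff[of T _ d k]
  by (auto simp: cube_def PiE_iff extensional_def)

lemma diff_prod_swap_blocks:
  assumes "T \<subseteq> {1..d}"
  shows "diff_prod d (z \<circ> swap_blocks T) \<alpha> = (-1) ^ card T * diff_prod d z \<alpha>"
proof -
  let ?u = "\<lambda>z i. z (X i (\<alpha> i)) - z (Y i (\<alpha> i)) :: int"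
  have "diff_prod d (z \<circ> swap_blocks T) \<alpha> =
      (\<Prod>i\<in>{1..d} - T. ?u (z \<circ> swap_blocks T) i) * (\<Prod>i\<in>T. ?u (z \<circ> swap_blocks T) i)"
    unfolding diff_prod_def using assms by (intro prod.subset_diff) auto
  also have "\<dots> = (\<Prod>i\<in>{1..d} - T. ?u z i) * (\<Prod>i\<in>T. - ?u z i)"
    by (intro arg_cong2[where f = "(*)"] prod.cong) (auto simp: swap_blocks_def)
  also have "\<dots> = (-1) ^ card T * ((\<Prod>i\<in>{1..d} - T. ?u z i) * (\<Prod>i\<in>T. ?u z i))"
    by (simp only: prod_uminus mult.left_commute)
  also have "(\<Prod>i\<in>{1..d} - T. ?u z i) * (\<Prod>i\<in>T. ?u z i) = diff_prod d z \<alpha>"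
    unfolding diff_prod_def using assms by (intro prod.subset_diff[symmetric]) auto
  finally show ?thesis .
qed

lemma prod_swap_blocks:
  fixes z :: "xy_var \<Rightarrow> int"
  assumes "finite M" "block ` M \<subseteq> {1..d}" "T \<subseteq> {1..d}"
  shows "(\<Prod>v\<in>M. (z \<circ> swap_blocks T) v) =
    (\<Prod>i\<in>T. \<Prod>v\<in>block_part M i. z (flip v)) *
    (\<Prod>i\<in>{1..d} - T. \<Prod>v\<in>block_part M i. z v)"
proof -
  let ?g = "\<lambda>i. \<Prod>v\<in>block_part M i. (z \<circ> swap_blocks T) v"
  have "(\<Prod>v\<in>M. (z \<circ> swap_blocks T) v) = (\<Prod>i=1..d. ?g i)"
    using assms(1,2) by (intro prod.group[symmetric]) auto
  also have "\<dots> = (\<Prod>i\<in>{1..d} - T. ?g i) * (\<Prod>i\<in>T. ?g i)"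
    using assms(3) by (intro prod.subset_diff) auto
  also have "(\<Prod>i\<in>T. ?g i) = (\<Prod>i\<in>T. \<Prod>v\<in>block_part M i. z (flip v))"
    by (intro prod.cong) (auto simp: swap_blocks_def)
  also have "(\<Prod>i\<in>{1..d} - T. ?g i) = (\<Prod>i\<in>{1..d} - T. \<Prod>v\<in>block_part M i. z v)"
    by (intro prod.cong) (auto simp: swap_blocks_def)
  finally show ?thesis by (simp only: mult.commute)
qed

lemma antisymmetrize_prod:
  assumes "finite M" "block ` M \<subseteq> {1..d}"
  shows "antisymmetrize d (\<lambda>z. \<Prod>v\<in>M. z v) z =
    (\<Prod>i=1..d. (\<Prod>v\<in>block_part M i. z v) - (\<Prod>v\<in>block_part M i. z (flip v)))"
  unfolding antisymmetrize_def prod_diff_conv_sum[OF finite_atLeastAtMost]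
  by (intro sum.cong refl) (simp add: prod_swap_blocks[OF assms] mult.assoc del: o_apply)

lemma antisymmetrize_prod_missing_block:
  assumes "finite M" "block ` M \<subset> {1..d}"
  shows "antisymmetrize d (\<lambda>z. \<Prod>v\<in>M. z v) z = 0"
proof -
  obtain i where i: "i \<in> {1..d}" "block_part M i = {}" using assms(2) by blast
  have "(\<Prod>v\<in>block_part M i. z v) - (\<Prod>v\<in>block_part M i. z (flip v)) = 0"
    unfolding i(2) by simp
  then show ?thesis
    unfolding antisymmetrize_prod[OF assms(1) psubset_imp_subset[OF assms(2)]]
    using i(1) by (intro prod_zero) auto
qed

lemma antisymmetrize_prod_transversal:
  assumes "bij_betw block M {1..d}"
  shows "antisymmetrize d (\<lambda>z. \<Prod>v\<in>M. z v) z =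
    (\<Prod>v\<in>M. orientation v) * diff_prod d z (\<lambda>i\<in>{1..d}. index (inv_into M block i))"
proof -
  have fin: "finite M" using assms bij_betw_finite by blast
  let ?w = "inv_into M block"
  have fibre: "block_part M i = {?w i}" if "i \<in> {1..d}" for i
    using that assms bij_betw_inv_into_left[OF assms] bij_betw_inv_into_right[OF assms that]
      bij_betwE[OF bij_betw_inv_into[OF assms]] by auto
  have "antisymmetrize d (\<lambda>z. \<Prod>v\<in>M. z v) z = (\<Prod>i=1..d. z (?w i) - z (flip (?w i)))"
    using assms fin by (simp add: antisymmetrize_prod bij_betw_imp_surj_on fibre)
  also have "\<dots> = (\<Prod>i=1..d. orientation (?w i)) * diff_prod d z (\<lambda>i\<in>{1..d}. index (?w i))"
    unfolding diff_prod_def prod.distrib[symmetric]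
    using bij_betw_inv_into_right[OF assms] by (intro prod.cong) (simp_all add: diff_flip[of z])
  also have "(\<Prod>i=1..d. orientation (?w i)) = (\<Prod>v\<in>M. orientation v)"
    using bij_betw_inv_into[OF assms] by (rule prod.reindex_bij_betw)
  finally show ?thesis .
qed

definition diff_form ::
  "nat \<Rightarrow> (nat \<Rightarrow> nat) \<Rightarrow> ((nat \<Rightarrow> nat) \<Rightarrow> int) \<Rightarrow> (xy_var \<Rightarrow> int) \<Rightarrow> int" where
  "diff_form d k c z = (\<Sum>\<alpha>\<in>K d k. c \<alpha> * diff_prod d z \<alpha>)"

lemma diff_form_single:
  assumes "\<alpha> \<in> K d k"
  shows "diff_form d k (\<lambda>\<beta>. if \<beta> = \<alpha> then s else 0) z = s * diff_prod d z \<alpha>"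
  unfolding diff_form_def using assms finite_K[of d k]
  by (simp add: if_distrib[of "\<lambda>a. a * _"] cong: if_cong)

lemma diff_form_linear_combination:
  "(\<Sum>m\<in>A. a m * diff_form d k (C m) z) = diff_form d k (\<lambda>\<alpha>. \<Sum>m\<in>A. a m * C m \<alpha>) z"
  unfolding diff_form_def sum_distrib_left sum_distrib_right
  by (subst sum.swap) (simp add: mult.assoc)

lemma antisymmetrize_prod_eq_diff_form:
  assumes "finite M" "M \<subseteq> xy_vars d k" "card M \<le> d"
  obtains c where "\<And>z. antisymmetrize d (\<lambda>z. \<Prod>v\<in>M. z v) z = diff_form d k c z"
proof (cases "block ` M = {1..d}")
  case True
  then have "card (block ` M) = card M"
    using assms(1,3) card_image_le[OF assms(1), of block] by simp
  then have bij: "bij_betw block M {1..d}"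
    using True assms(1) by (simp add: bij_betw_def eq_card_imp_inj_on)
  let ?\<alpha> = "\<lambda>i\<in>{1..d}. index (inv_into M block i)"
  have "?\<alpha> \<in> K d k"
    unfolding K_def
  proof (rule restrict_PiE_iff[THEN iffD2], rule ballI)
    fix i assume "i \<in> {1..d}"
    then have "inv_into M block i \<in> xy_vars d k" "block (inv_into M block i) = i"
      using True assms(2) by (auto simp: inv_into_into f_inv_into_f)
    then show "index (inv_into M block i) \<in> {1..k i}" by (simp add: mem_xy_vars_iff)
  qed
  then show thesis
    using that antisymmetrize_prod_transversal[OF bij] diff_form_single by metis
next
  case False
  then have "block ` M \<subset> {1..d}" using assms(2) by (auto simp: mem_xy_vars_iff)
  then have "antisymmetrize d (\<lambda>z. \<Prod>v\<in>M. z v) z = diff_form d k (\<lambda>_. 0) z" for z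
    using antisymmetrize_prod_missing_block[OF assms(1)] by (simp add: diff_form_def)
  then show thesis by (rule that)
qed

lemma antisymmetrize_mpoly_eval:
  "antisymmetrize d (mpoly_eval p) z =
    (\<Sum>m\<in>Poly_Mapping.keys p. Poly_Mapping.lookup p m * antisymmetrize d (monom_eval m) z)"
  unfolding antisymmetrize_def mpoly_eval_conv_monom_eval sum_distrib_left
  by (subst sum.swap) (simp add: mult.left_commute)

lemma antisymmetrize_monom_eval:
  assumes "z \<in> cube (xy_vars d k)" "Poly_Mapping.keys m \<subseteq> xy_vars d k"
  shows "antisymmetrize d (monom_eval m) z =
    antisymmetrize d (\<lambda>z. \<Prod>v\<in>Poly_Mapping.keys m. z v) z"
  unfolding antisymmetrize_def
  by (simp only: monom_eval_cube[OF cube_swap_blocks[OF assms(1)] assms(2)])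

lemma antisymmetrize_mpoly_eq_diff_form:
  assumes "p \<in> mpolys (xy_vars d k) d"
  obtains c where "\<And>z. z \<in> cube (xy_vars d k) \<Longrightarrow>
    antisymmetrize d (mpoly_eval p) z = diff_form d k c z"
proof -
  have "\<exists>c. \<forall>z\<in>cube (xy_vars d k). antisymmetrize d (monom_eval m) z = diff_form d k c z"
    if "m \<in> Poly_Mapping.keys p" for m
  proof -
    have m: "Poly_Mapping.keys m \<subseteq> xy_vars d k" "card (Poly_Mapping.keys m) \<le> d"
      using assms that card_keys_le_monom_degree[of m] by (auto simp: mpolys_iff)
    obtain c where "\<And>z. antisymmetrize d (\<lambda>z. \<Prod>v\<in>Poly_Mapping.keys m. z v) z = diff_form d k c z"
      using antisymmetrize_prod_eq_diff_form[OF finite_keys m] by blast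
    then show ?thesis using antisymmetrize_monom_eval[OF _ m(1)] by metis
  qed
  then obtain C where C: "\<And>m z. m \<in> Poly_Mapping.keys p \<Longrightarrow> z \<in> cube (xy_vars d k) \<Longrightarrow>
      antisymmetrize d (monom_eval m) z = diff_form d k (C m) z"
    by metis
  show thesis
  proof (rule that)
    fix z assume "z \<in> cube (xy_vars d k)"
    then show "antisymmetrize d (mpoly_eval p) z =
        diff_form d k (\<lambda>\<alpha>. \<Sum>m\<in>Poly_Mapping.keys p. Poly_Mapping.lookup p m * C m \<alpha>) z"
      by (simp add: antisymmetrize_mpoly_eval C diff_form_linear_combination)
  qed
qed

lemma antisymmetrize_eq_0_if_degree_less:
  assumes "p \<in> mpolys (xy_vars d k) D" "D < d" "z \<in> cube (xy_vars d k)"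
  shows "antisymmetrize d (mpoly_eval p) z = 0"
  unfolding antisymmetrize_mpoly_eval
proof (intro sum.neutral ballI)
  fix m assume "m \<in> Poly_Mapping.keys p"
  then have m: "Poly_Mapping.keys m \<subseteq> xy_vars d k" "card (Poly_Mapping.keys m) < d"
    using assms(1,2) card_keys_le_monom_degree[of m] by (auto simp: mpolys_iff)
  have "block ` Poly_Mapping.keys m \<noteq> {1..d}"
    using m(2) card_image_le[OF finite_keys, of block m] by auto
  then have "block ` Poly_Mapping.keys m \<subset> {1..d}"
    using m(1) by (auto simp: mem_xy_vars_iff)
  then show "Poly_Mapping.lookup p m * antisymmetrize d (monom_eval m) z = 0"
    by (simp add: antisymmetrize_monom_eval[OF assms(3) m(1)] antisymmetrize_prod_missing_block)
qed

lemma abs_antisymmetrize_le_weight: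
  assumes "mpoly_vars p \<subseteq> xy_vars d k" "z \<in> cube (xy_vars d k)"
  shows "\<bar>antisymmetrize d (mpoly_eval p) z\<bar> \<le> 2 ^ d * int (mpoly_weight p)"
proof -
  have "\<bar>antisymmetrize d (mpoly_eval p) z\<bar> \<le>
      (\<Sum>T\<in>Pow {1..d}. \<bar>(-1) ^ card T * mpoly_eval p (z \<circ> swap_blocks T)\<bar>)"
    unfolding antisymmetrize_def by (rule sum_abs)
  also have "\<dots> \<le> (\<Sum>T\<in>Pow {1..d}. int (mpoly_weight p))"
    using abs_mpoly_eval_le_weight[OF cube_swap_blocks[OF assms(2)] assms(1)]
    by (intro sum_mono) (simp add: abs_mult power_abs)
  also have "\<dots> = 2 ^ d * int (mpoly_weight p)" by (simp add: card_Pow)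
  finally show ?thesis .
qed

lemma xy_fun_is_largest:
  assumes "is_largest d k (nonvanishing d k z) \<alpha>"
  shows "xy_fun d k z = sgn01 (diff_prod d z \<alpha>)"
proof -
  have nonempty: "nonvanishing d k z \<noteq> {}" using assms by (auto simp: is_largest_def)
  have "(THE \<alpha>. is_largest d k (nonvanishing d k z) \<alpha>) = \<alpha>"
    using ex1_is_largest[OF _ nonempty] assms by (intro the1_equality) (auto simp: nonvanishing_def)
  then show ?thesis using nonempty by (simp add: xy_fun_def)
qed

lemma xy_fun_swap_blocks:
  assumes "T \<subseteq> {1..d}" "is_largest d k (nonvanishing d k z) \<alpha>"
  shows "xy_fun d k (z \<circ> swap_blocks T) = sgn01 ((-1) ^ card T * diff_prod d z \<alpha>)"
proof -
  have "nonvanishing d k (z \<circ> swap_blocks T) = nonvanishing d k z"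
    by (simp add: nonvanishing_def diff_prod_swap_blocks[OF assms(1)])
  then show ?thesis
    using xy_fun_is_largest[of d k "z \<circ> swap_blocks T" \<alpha>] assms
    by (simp add: diff_prod_swap_blocks)
qed

lemma antisymmetrize_gate_pos:
  assumes "d \<ge> 1" "threshold_gate (xy_vars d k) (xy_fun d k) p" "z \<in> cube (xy_vars d k)"
    and "is_largest d k (nonvanishing d k z) \<alpha>" "diff_prod d z \<alpha> > 0"
  shows "antisymmetrize d (mpoly_eval p) z > 0"
proof -
  have sgn: "sgn01 (mpoly_eval p (z \<circ> swap_blocks T)) = sgn01 ((-1) ^ card T * diff_prod d z \<alpha>)"
    if "T \<subseteq> {1..d}" for T
    using xy_fun_swap_blocks[OF that assms(4)] assms(2) cube_swap_blocks[OF assms(3), of T]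
    by (simp add: threshold_gate_def)
  have "0 \<le> (-1) ^ card T * mpoly_eval p (z \<circ> swap_blocks T)" if "T \<subseteq> {1..d}" for T
    using sgn[OF that] assms(5) by (cases "even (card T)") (auto simp: sgn01_def split: if_splits)
  \<comment> \<open>A gate may vanish where \<open>f = 1\<close>, so strictness comes from an odd swap.\<close>
  moreover have "0 < (-1) ^ card {1::nat} * mpoly_eval p (z \<circ> swap_blocks {1})"
    using sgn[of "{1}"] assms(1,5) by (auto simp: sgn01_def split: if_splits)
  ultimately show ?thesis
    unfolding antisymmetrize_def using assms(1) by (intro sum_pos2[of _ "{1}"]) auto
qed


section \<open>Test points\<close>

definition predecessors :: "(nat \<Rightarrow> nat) \<Rightarrow> (nat \<Rightarrow> nat) \<Rightarrow> nat \<Rightarrow> nat set" where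
  "predecessors k \<beta> l = {j \<in> {1..k l}. precedes (ind k \<beta> l) j (\<beta> l)}"

text \<open>Evaluating on \<open>u\<^sup>l = e(\<beta>\<^sub>l) - (\<Sum>j\<in>S. e(j))\<close> and \<open>u\<^sup>i = e(\<beta>\<^sub>i)\<close> for \<open>i \<noteq> l\<close>,
  where \<open>u\<^sup>i = x\<^sup>i - y\<^sup>i\<close>, makes \<open>\<beta>\<close> the leading index.\<close>

definition test_point :: "nat \<Rightarrow> (nat \<Rightarrow> nat) \<Rightarrow> (nat \<Rightarrow> nat) \<Rightarrow> nat \<Rightarrow> nat set \<Rightarrow> xy_var \<Rightarrow> int" where
  "test_point d k \<beta> l S = restrict
     (\<lambda>v. case v of X i j \<Rightarrow> of_bool (j = \<beta> i) | Y i j \<Rightarrow> of_bool (i = l \<and> j \<in> S)) (xy_vars d k)"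

lemma test_point_in_cube: "test_point d k \<beta> l S \<in> cube (xy_vars d k)"
  unfolding cube_def test_point_def by (auto simp: of_bool_def split: xy_var.split)

lemma not_mem_predecessors: "\<beta> l \<notin> predecessors k \<beta> l"
  by (simp add: predecessors_def precedes_def)

lemma fun_upd_in_K: "\<beta> \<in> K d k \<Longrightarrow> l \<in> {1..d} \<Longrightarrow> j \<in> {1..k l} \<Longrightarrow> \<beta>(l := j) \<in> K d k"
  unfolding K_def by (auto simp: PiE_iff extensional_def)

lemma K_less_fun_upd:
  assumes "l \<in> {1..d}" "j \<in> predecessors k \<beta> l"
  shows "K_less d k (\<beta>(l := j)) \<beta>"
proof -
  have "ind k (\<beta>(l := j)) l = ind k \<beta> l" by (rule ind_cong) auto
  then show ?thesis
    unfolding K_less_def using assms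
    by (intro bexI[of _ l]) (auto simp: predecessors_def precedes_def split: if_splits)
qed

lemma mem_K_eq_fun_upd:
  assumes "\<alpha> \<in> K d k" "\<beta> \<in> K d k" "l \<in> {1..d}" "\<And>i. i \<in> {1..d} - {l} \<Longrightarrow> \<alpha> i = \<beta> i"
  shows "\<alpha> = \<beta>(l := \<alpha> l)"
  using assms unfolding K_def
  by (intro extensionalityI[of _ "{1..d}"]) (auto simp: PiE_iff extensional_def)

lemma diff_prod_test_point_eq_prod:
  assumes "\<alpha> \<in> K d k"
  shows "diff_prod d (test_point d k \<beta> l S) \<alpha> =
    (\<Prod>i=1..d. of_bool (\<alpha> i = \<beta> i) - of_bool (i = l \<and> \<alpha> i \<in> S))"
  unfolding diff_prod_def
proof (rule prod.cong)
  fix i assume "i \<in> {1..d}"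
  then show "test_point d k \<beta> l S (X i (\<alpha> i)) - test_point d k \<beta> l S (Y i (\<alpha> i)) =
      of_bool (\<alpha> i = \<beta> i) - of_bool (i = l \<and> \<alpha> i \<in> S)"
    by (simp add: test_point_def mem_K_imp_mem_xy_vars[OF assms])
qed simp

lemma diff_prod_test_point_self:
  assumes "\<beta> \<in> K d k" "\<beta> l \<notin> S"
  shows "diff_prod d (test_point d k \<beta> l S) \<beta> = 1"
  unfolding diff_prod_test_point_eq_prod[OF assms(1)] using assms(2) by (intro prod.neutral) auto

lemma diff_prod_test_point_fun_upd:
  assumes "\<beta> \<in> K d k" "l \<in> {1..d}" "S \<subseteq> {1..k l}" "\<beta> l \<notin> S" "j \<in> S"
  shows "diff_prod d (test_point d k \<beta> l S) (\<beta>(l := j)) = -1"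
proof -
  let ?t = "\<lambda>i. of_bool ((\<beta>(l := j)) i = \<beta> i) - of_bool (i = l \<and> (\<beta>(l := j)) i \<in> S) :: int"
  have "\<beta>(l := j) \<in> K d k" using assms by (intro fun_upd_in_K) auto
  then have "diff_prod d (test_point d k \<beta> l S) (\<beta>(l := j)) = (\<Prod>i=1..d. ?t i)"
    by (rule diff_prod_test_point_eq_prod)
  also have "\<dots> = ?t l * (\<Prod>i\<in>{1..d} - {l}. ?t i)" using assms(2) by (intro prod.remove) auto
  also have "(\<Prod>i\<in>{1..d} - {l}. ?t i) = 1" by (intro prod.neutral) auto
  also have "?t l = -1" using assms(4,5) by auto
  finally show ?thesis by (simp del: fun_upd_apply)
qed

lemma diff_prod_test_point_other:
  assumes "\<beta> \<in> K d k" "\<alpha> \<in> K d k" "l \<in> {1..d}" "\<alpha> \<noteq> \<beta>" "\<alpha> \<notin> (\<lambda>j. \<beta>(l := j)) ` S"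
  shows "diff_prod d (test_point d k \<beta> l S) \<alpha> = 0"
proof -
  have "\<exists>i\<in>{1..d}. \<alpha> i \<noteq> \<beta> i \<and> \<not> (i = l \<and> \<alpha> i \<in> S)"
  proof (rule ccontr)
    assume no_zero_factor: "\<not> ?thesis"
    then have "\<alpha> = \<beta>(l := \<alpha> l)" using assms(1-3) by (intro mem_K_eq_fun_upd) auto
    moreover have "\<alpha> l = \<beta> l \<or> \<alpha> l \<in> S" using no_zero_factor assms(3) by auto
    ultimately show False using assms(4,5) by (metis fun_upd_triv imageI)
  qed
  then show ?thesis
    unfolding diff_prod_test_point_eq_prod[OF assms(2)] by (intro prod_zero) auto
qed

lemma is_largest_test_point:
  assumes "\<beta> \<in> K d k" "l \<in> {1..d}" "S \<subseteq> predecessors k \<beta> l"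
  shows "is_largest d k (nonvanishing d k (test_point d k \<beta> l S)) \<beta>"
proof -
  have "\<beta> l \<notin> S" using assms(3) not_mem_predecessors by blast
  then have "\<beta> \<in> nonvanishing d k (test_point d k \<beta> l S)"
    using assms(1) by (simp add: nonvanishing_def diff_prod_test_point_self)
  moreover have "nonvanishing d k (test_point d k \<beta> l S) \<subseteq> insert \<beta> ((\<lambda>j. \<beta>(l := j)) ` S)"
    using diff_prod_test_point_other[OF assms(1) _ assms(2)] by (auto simp: nonvanishing_def)
  ultimately show ?thesis
    unfolding is_largest_def using K_less_fun_upd[OF assms(2)] assms(3) by blast
qed

lemma antisymmetrize_gate_test_point_pos:
  assumes "d \<ge> 1" "threshold_gate (xy_vars d k) (xy_fun d k) p"
    and "\<beta> \<in> K d k" "l \<in> {1..d}" "S \<subseteq> predecessors k \<beta> l"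
  shows "0 < antisymmetrize d (mpoly_eval p) (test_point d k \<beta> l S)"
proof -
  have "\<beta> l \<notin> S" using assms(5) not_mem_predecessors by blast
  then have "0 < diff_prod d (test_point d k \<beta> l S) \<beta>"
    using assms(3) by (simp add: diff_prod_test_point_self)
  then show ?thesis
    using antisymmetrize_gate_pos[OF assms(1,2) test_point_in_cube]
      is_largest_test_point[OF assms(3-5)]
    by blast
qed

lemma diff_form_test_point:
  assumes "\<beta> \<in> K d k" "l \<in> {1..d}" "S \<subseteq> {1..k l}" "\<beta> l \<notin> S"
  shows "diff_form d k c (test_point d k \<beta> l S) = c \<beta> - (\<Sum>j\<in>S. c (\<beta>(l := j)))"
proof -
  let ?u = "diff_prod d (test_point d k \<beta> l S)"
  let ?I = "(\<lambda>j. \<beta>(l := j)) ` S"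
  have I: "?I \<subseteq> K d k" using fun_upd_in_K[OF assms(1,2)] assms(3) by auto
  have notin: "\<beta> \<notin> ?I" using assms(4) by (metis (no_types, lifting) fun_upd_same imageE)
  have inj: "inj_on (\<lambda>j. \<beta>(l := j)) S" by (rule inj_onI) (metis fun_upd_same)
  have "diff_form d k c (test_point d k \<beta> l S) = (\<Sum>\<alpha>\<in>insert \<beta> ?I. c \<alpha> * ?u \<alpha>)"
    unfolding diff_form_def
    using I assms(1) finite_K diff_prod_test_point_other[OF assms(1) _ assms(2)]
    by (intro sum.mono_neutral_right) auto
  also have "\<dots> = c \<beta> * ?u \<beta> + (\<Sum>\<alpha>\<in>?I. c \<alpha> * ?u \<alpha>)"
    using notin finite_subset[OF I finite_K] by simp
  also have "(\<Sum>\<alpha>\<in>?I. c \<alpha> * ?u \<alpha>) = (\<Sum>j\<in>S. - c (\<beta>(l := j)))"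
    using diff_prod_test_point_fun_upd[OF assms] by (simp add: sum.reindex[OF inj])
  also have "?u \<beta> = 1" using assms(1,4) by (rule diff_prod_test_point_self)
  finally show ?thesis by (simp add: sum_negf del: fun_upd_apply)
qed


section \<open>Growth of the coefficients\<close>

definition dominating :: "nat \<Rightarrow> (nat \<Rightarrow> nat) \<Rightarrow> ((nat \<Rightarrow> nat) \<Rightarrow> int) \<Rightarrow> bool" where
  "dominating d k c \<longleftrightarrow>
     (\<forall>\<beta>\<in>K d k. \<forall>l\<in>{1..d}. \<forall>S\<subseteq>predecessors k \<beta> l. (\<Sum>j\<in>S. c (\<beta>(l := j))) < c \<beta>)"

lemma dominatingD:
  "dominating d k c \<Longrightarrow> \<beta> \<in> K d k \<Longrightarrow> l \<in> {1..d} \<Longrightarrow> S \<subseteq> predecessors k \<beta> l \<Longrightarrow>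
    (\<Sum>j\<in>S. c (\<beta>(l := j))) < c \<beta>"
  by (simp add: dominating_def)

lemma dominating_pos: "dominating d k c \<Longrightarrow> d \<ge> 1 \<Longrightarrow> \<beta> \<in> K d k \<Longrightarrow> 0 < c \<beta>"
  using dominatingD[of d k c \<beta> 1 "{}"] by simp

lemma gate_coefficients:
  assumes "d \<ge> 1" "threshold_gate (xy_vars d k) (xy_fun d k) p" "mpoly_degree p \<le> d"
  obtains c where "dominating d k c" "\<And>\<beta>. \<beta> \<in> K d k \<Longrightarrow> c \<beta> \<le> 2 ^ d * int (mpoly_weight p)"
proof -
  have vars: "mpoly_vars p \<subseteq> xy_vars d k" using assms(2) by (simp add: threshold_gate_def)
  then have "p \<in> mpolys (xy_vars d k) d" using assms(3) by (simp add: mpolys_def)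
  then obtain c where form: "\<And>z. z \<in> cube (xy_vars d k) \<Longrightarrow>
      antisymmetrize d (mpoly_eval p) z = diff_form d k c z"
    using antisymmetrize_mpoly_eq_diff_form by blast
  have at_test_point: "antisymmetrize d (mpoly_eval p) (test_point d k \<beta> l S) =
      c \<beta> - (\<Sum>j\<in>S. c (\<beta>(l := j)))"
    if "\<beta> \<in> K d k" "l \<in> {1..d}" "S \<subseteq> predecessors k \<beta> l" for \<beta> l S
    unfolding form[OF test_point_in_cube] using that not_mem_predecessors[of \<beta> l k]
    by (intro diff_form_test_point) (auto simp: predecessors_def)
  have "(\<Sum>j\<in>S. c (\<beta>(l := j))) < c \<beta>"
    if "\<beta> \<in> K d k" "l \<in> {1..d}" "S \<subseteq> predecessors k \<beta> l" for \<beta> l S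
    using antisymmetrize_gate_test_point_pos[OF assms(1,2) that] at_test_point[OF that] by simp
  then have "dominating d k c" by (simp add: dominating_def)
  moreover have "c \<beta> \<le> 2 ^ d * int (mpoly_weight p)" if "\<beta> \<in> K d k" for \<beta>
    using at_test_point[OF that, of 1 "{}"] assms(1)
      abs_antisymmetrize_le_weight[OF vars test_point_in_cube[of d k \<beta> 1 "{}"]] by simp
  ultimately show thesis using that by blast
qed

lemma superincreasing_sum_ge:
  fixes v :: "nat \<Rightarrow> 'a::linordered_idom"
  assumes "n \<ge> 1" "v 1 \<ge> 0" "\<And>p. p \<in> {2..n} \<Longrightarrow> (\<Sum>q=1..<p. v q) \<le> v p"
  shows "2 ^ (n - 1) * v 1 \<le> (\<Sum>q=1..n. v q)"
  using assms
proof (induction n rule: dec_induct)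
  case base
  then show ?case by simp
next
  case (step n)
  have "(\<Sum>q=1..<Suc n. v q) \<le> v (Suc n)" using step.hyps step.prems(2)[of "Suc n"] by simp
  then have "(\<Sum>q=1..n. v q) \<le> v (Suc n)" by (simp add: atLeastLessThanSuc_atLeastAtMost)
  moreover have "2 ^ (n - 1) * v 1 \<le> (\<Sum>q=1..n. v q)"
    using step.prems by (intro step.IH) auto
  moreover have "(2::'a) ^ n = 2 * 2 ^ (n - 1)" using step.hyps by (cases n) auto
  ultimately show ?case using step.hyps by (simp add: mult.assoc)
qed

lemma linked_runs_growth:
  fixes u v :: "nat \<Rightarrow> 'a::linordered_semidom"
  assumes "n \<ge> 1" "r \<ge> 0" "\<And>p. p \<in> {1..n} \<Longrightarrow> r * u p \<le> v p"
    and "\<And>p. p \<in> {1..<n} \<Longrightarrow> v p \<le> u (Suc p)"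
  shows "r ^ n * u 1 \<le> v n"
  using assms
proof (induction n rule: dec_induct)
  case base
  then show ?case by simp
next
  case (step n)
  have "r ^ Suc n * u 1 = r * (r ^ n * u 1)" by (simp add: mult.assoc)
  also have "\<dots> \<le> r * v n" using step by (intro mult_left_mono) auto
  also have "\<dots> \<le> r * u (Suc n)" using step by (intro mult_left_mono) auto
  also have "\<dots> \<le> v (Suc n)" using step.prems step.hyps by auto
  finally show ?case .
qed

text \<open>Since \<open>num n b\<close> is an involution, \<open>num n b p\<close> is also the element at position \<open>p\<close>.\<close>

lemma num_mem: "j \<in> {1..n} \<Longrightarrow> num n b j \<in> {1..n}"
  by (auto simp: num_def)

lemma num_num: "j \<in> {1..n} \<Longrightarrow> num n b (num n b j) = j"
  by (auto simp: num_def)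

lemma precedes_num_iff:
  "p \<in> {1..n} \<Longrightarrow> q \<in> {1..n} \<Longrightarrow> precedes b (num n b p) (num n b q) \<longleftrightarrow> p < q"
  by (auto simp: precedes_def num_def)

text \<open>The \<open>p\<close>-th of the cells into which the coordinate \<open>l\<close> divides the set of all \<open>\<beta> \<in> K\<close> that
  agree with \<open>\<alpha>\<close> below \<open>l\<close> is represented by its element with entries 1 above \<open>l\<close>.\<close>

definition cell_elem :: "nat \<Rightarrow> (nat \<Rightarrow> nat) \<Rightarrow> nat \<Rightarrow> (nat \<Rightarrow> nat) \<Rightarrow> nat \<Rightarrow> nat \<Rightarrow> nat" where
  "cell_elem d k l \<alpha> p = (\<lambda>i. if i < l then \<alpha> i else if i = l then num (k l) (ind k \<alpha> l) p
     else if i \<le> d then 1 else undefined)"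

lemma cell_elem_in_K:
  assumes "\<alpha> \<in> K d k" "l \<in> {1..d}" "p \<in> {1..k l}"
  shows "cell_elem d k l \<alpha> p \<in> K d k"
proof -
  have "1 \<le> k i" if "i \<in> {1..d}" for i using assms(1) that by (rule mem_K_imp_length_pos)
  then show ?thesis
    using assms num_mem[OF assms(3)] unfolding K_def cell_elem_def
    by (auto simp: PiE_iff extensional_def)
qed

lemma ind_cell_elem: "ind k (cell_elem d k l \<alpha> p) l = ind k \<alpha> l"
  by (rule ind_cong) (simp add: cell_elem_def)

lemma ind_Suc_cell_elem:
  assumes "l \<ge> 1" "p \<in> {1..k l}"
  shows "ind k (cell_elem d k l \<alpha> p) (Suc l) = p mod 2"
proof -
  obtain l' where l': "l = Suc l'" using assms(1) by (cases l) auto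
  have "ind k (cell_elem d k l \<alpha> p) (Suc l) =
      num (k l) (ind k (cell_elem d k l \<alpha> p) l) (cell_elem d k l \<alpha> p l) mod 2"
    unfolding l' by simp
  also have "\<dots> = p mod 2"
    unfolding ind_cell_elem using num_num[OF assms(2)] by (simp add: cell_elem_def)
  finally show ?thesis .
qed

lemma cell_elem_fun_upd:
  "(cell_elem d k l \<alpha> p)(l := num (k l) (ind k \<alpha> l) q) = cell_elem d k l \<alpha> q"
  by (auto simp: cell_elem_def)

lemma predecessors_cell_elem:
  assumes "p \<in> {1..k l}"
  shows "num (k l) (ind k \<alpha> l) ` {1..<p} \<subseteq> predecessors k (cell_elem d k l \<alpha> p) l"
  unfolding predecessors_def ind_cell_elem
  using assms num_mem precedes_num_iff by (force simp: cell_elem_def)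

text \<open>The order on \<open>K\<close> is a Gray code: the last element of a cell and the first element of the next
  one differ in the coordinate \<open>l\<close> only.\<close>

lemma cell_elem_Suc_last_conv_first:
  assumes "1 \<le> l" "l < d" "p \<in> {1..<k l}" "1 \<le> k (Suc l)"
  shows "cell_elem d k (Suc l) (cell_elem d k l \<alpha> p) (k (Suc l)) =
    (cell_elem d k (Suc l) (cell_elem d k l \<alpha> (Suc p)) 1)(l := num (k l) (ind k \<alpha> l) p)"
proof -
  have "num (k (Suc l)) (p mod 2) (k (Suc l)) = num (k (Suc l)) (Suc p mod 2) 1"
    using assms(4) by (cases "even p") (auto simp: num_def mod_Suc even_iff_mod_2_eq_zero)
  then show ?thesis
    using assms(1-3) ind_Suc_cell_elem[of l p k d \<alpha>] ind_Suc_cell_elem[of l "Suc p" k d \<alpha>]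
    unfolding cell_elem_def[of d k "Suc l"] by (auto simp: cell_elem_def)
qed

lemma cell_elem_Suc_first:
  assumes "1 \<le> l" "l < d" "1 \<le> k l"
  shows "cell_elem d k (Suc l) (cell_elem d k l \<alpha> 1) 1 = cell_elem d k l \<alpha> 1"
  using assms ind_Suc_cell_elem[of l 1 k d \<alpha>]
  unfolding cell_elem_def[of d k "Suc l"] by (auto simp: num_def cell_elem_def)

text \<open>Here evenness enters: the last cell is traversed backwards, hence ends in 1.\<close>

lemma cell_elem_Suc_last:
  assumes "1 \<le> l" "l < d" "1 \<le> k l" "even (k l)" "1 \<le> k (Suc l)"
  shows "cell_elem d k (Suc l) (cell_elem d k l \<alpha> (k l)) (k (Suc l)) = cell_elem d k l \<alpha> (k l)"
  using assms ind_Suc_cell_elem[of l "k l" k d \<alpha>]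
  unfolding cell_elem_def[of d k "Suc l"] by (auto simp: num_def cell_elem_def)

lemma dominating_sum_cell_elem_less:
  assumes "dominating d k c" "\<alpha> \<in> K d k" "l \<in> {1..d}" "p \<in> {1..k l}"
  shows "(\<Sum>q=1..<p. c (cell_elem d k l \<alpha> q)) < c (cell_elem d k l \<alpha> p)"
proof -
  let ?num = "num (k l) (ind k \<alpha> l)"
  have "inj_on ?num {1..<p}"
    using assms(4) num_num by (intro inj_on_inverseI[of _ ?num]) auto
  then have "(\<Sum>q=1..<p. c (cell_elem d k l \<alpha> q)) =
      (\<Sum>j\<in>?num ` {1..<p}. c ((cell_elem d k l \<alpha> p)(l := j)))"
    by (simp add: sum.reindex cell_elem_fun_upd)
  also have "\<dots> < c (cell_elem d k l \<alpha> p)"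
    using assms
    by (intro dominatingD[where d = d and k = k] cell_elem_in_K predecessors_cell_elem) simp_all
  finally show ?thesis .
qed

lemma dominating_run_growth:
  assumes "dominating d k c" "\<alpha> \<in> K d k" "l \<in> {1..d}"
  shows "2 ^ (k l - 2) * c (cell_elem d k l \<alpha> 1) \<le> c (cell_elem d k l \<alpha> (k l))"
proof (cases "k l \<le> 1")
  case True
  moreover have "1 \<le> k l" using assms(2,3) by (rule mem_K_imp_length_pos)
  ultimately show ?thesis by simp
next
  case False
  define v where "v p = c (cell_elem d k l \<alpha> p)" for p
  have less: "(\<Sum>q=1..<p. v q) < v p" if "p \<in> {1..k l}" for p
    unfolding v_def using assms that by (rule dominating_sum_cell_elem_less)
  have "2 ^ (k l - 1 - 1) * v 1 \<le> (\<Sum>q=1..k l - 1. v q)"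
    using less less[of 1] False by (intro superincreasing_sum_ge) (auto intro!: less_imp_le)
  also have "{1..k l - 1} = {1..<k l}" using False by auto
  also have "(\<Sum>q\<in>{1..<k l}. v q) \<le> v (k l)" using less[of "k l"] False by simp
  finally show ?thesis by (simp add: v_def numeral_2_eq_2)
qed

lemma dominating_last_le_next_first:
  assumes "dominating d k c" "\<alpha> \<in> K d k" "1 \<le> l" "l < d" "p \<in> {1..<k l}"
  shows "c (cell_elem d k (Suc l) (cell_elem d k l \<alpha> p) (k (Suc l)))
    \<le> c (cell_elem d k (Suc l) (cell_elem d k l \<alpha> (Suc p)) 1)"
proof -
  let ?\<beta> = "cell_elem d k (Suc l) (cell_elem d k l \<alpha> (Suc p)) 1"
  let ?j = "num (k l) (ind k \<alpha> l) p"
  have k_Suc: "1 \<le> k (Suc l)" using assms(2,4) by (intro mem_K_imp_length_pos) auto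
  have \<beta>: "?\<beta> \<in> K d k" using assms k_Suc by (intro cell_elem_in_K) auto
  have "ind k ?\<beta> l = ind k \<alpha> l" by (rule ind_cong) (simp add: cell_elem_def)
  moreover have "?\<beta> l = num (k l) (ind k \<alpha> l) (Suc p)" by (simp add: cell_elem_def)
  moreover have "?j \<in> {1..k l}" using assms(5) by (intro num_mem) auto
  moreover have "precedes (ind k \<alpha> l) ?j (num (k l) (ind k \<alpha> l) (Suc p))"
    using assms(5) by (subst precedes_num_iff) auto
  ultimately have "?j \<in> predecessors k ?\<beta> l" by (simp add: predecessors_def)
  then have "c (?\<beta>(l := ?j)) < c ?\<beta>"
    using dominatingD[OF assms(1) \<beta>, of l "{?j}"] assms(3,4) by simp
  then show ?thesis
    unfolding cell_elem_Suc_last_conv_first[OF assms(3-5) k_Suc] by (rule less_imp_le)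
qed

lemma dominating_cell_growth:
  assumes "dominating d k c" "\<forall>i\<in>{1..<d}. even (k i)" "1 \<le> l" "l \<le> d" "\<alpha> \<in> K d k"
  shows "2 ^ ((k d - 2) * (\<Prod>i=l..<d. k i)) * c (cell_elem d k l \<alpha> 1)
    \<le> c (cell_elem d k l \<alpha> (k l))"
  using \<open>l \<le> d\<close> \<open>1 \<le> l\<close> \<open>\<alpha> \<in> K d k\<close>
proof (induction l arbitrary: \<alpha> rule: inc_induct)
  case base
  then show ?case using dominating_run_growth[OF assms(1)] by simp
next
  case (step l)
  have k: "1 \<le> k l" "1 \<le> k (Suc l)"
    using step mem_K_imp_length_pos[OF step.prems(2), of l]
      mem_K_imp_length_pos[OF step.prems(2), of "Suc l"] by auto
  define E where "E = (k d - 2) * (\<Prod>i=Suc l..<d. k i)"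
  let ?first = "\<lambda>p. cell_elem d k (Suc l) (cell_elem d k l \<alpha> p) 1"
  let ?last = "\<lambda>p. cell_elem d k (Suc l) (cell_elem d k l \<alpha> p) (k (Suc l))"
  have "(2 ^ E) ^ k l * c (?first 1) \<le> c (?last (k l))"
  proof (rule linked_runs_growth[where u = "\<lambda>p. c (?first p)" and v = "\<lambda>p. c (?last p)"])
    show "2 ^ E * c (?first p) \<le> c (?last p)" if "p \<in> {1..k l}" for p
      unfolding E_def using step that by (intro step.IH cell_elem_in_K) auto
    show "c (?last p) \<le> c (?first (Suc p))" if "p \<in> {1..<k l}" for p
      using assms(1) step that by (intro dominating_last_le_next_first) auto
  qed (use k in auto)
  also have "?first 1 = cell_elem d k l \<alpha> 1"
    using step k by (intro cell_elem_Suc_first) auto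
  also have "?last (k l) = cell_elem d k l \<alpha> (k l)"
    using step k assms(2) by (intro cell_elem_Suc_last) auto
  also have "(2 ^ E) ^ k l = (2::int) ^ ((k d - 2) * (\<Prod>i=l..<d. k i))"
    using step.hyps by (simp add: E_def prod.atLeast_Suc_lessThan power_mult[symmetric] mult_ac)
  finally show ?case .
qed


section \<open>A gate of degree \<open>d\<close>\<close>

definition K_rank :: "nat \<Rightarrow> (nat \<Rightarrow> nat) \<Rightarrow> (nat \<Rightarrow> nat) \<Rightarrow> nat" where
  "K_rank d k \<alpha> = card {\<beta> \<in> K d k. K_less d k \<beta> \<alpha>}"

lemma K_rank_less:
  assumes "\<alpha> \<in> K d k" "K_less d k \<alpha> \<beta>"
  shows "K_rank d k \<alpha> < K_rank d k \<beta>"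
  unfolding K_rank_def
proof (rule psubset_card_mono)
  show "finite {\<gamma> \<in> K d k. K_less d k \<gamma> \<beta>}" using finite_K by simp
  show "{\<gamma> \<in> K d k. K_less d k \<gamma> \<alpha>} \<subset> {\<gamma> \<in> K d k. K_less d k \<gamma> \<beta>}"
    using assms K_less_irrefl K_less_trans by blast
qed

lemma inj_on_K_rank: "inj_on (K_rank d k) (K d k)"
  using K_less_total K_rank_less by (metis inj_onI less_irrefl)

lemma abs_diff_prod_le_1:
  assumes "z \<in> cube (xy_vars d k)" "\<alpha> \<in> K d k"
  shows "\<bar>diff_prod d z \<alpha>\<bar> \<le> 1"
  unfolding diff_prod_def
proof (rule abs_prod_le_1)
  fix i assume "i \<in> {1..d}"
  then show "\<bar>z (X i (\<alpha> i)) - z (Y i (\<alpha> i))\<bar> \<le> 1"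
    using mem_K_imp_mem_xy_vars[OF assms(2), THEN cube_01[OF assms(1)]] by force
qed

lemma abs_sum_distinct_powers_less:
  fixes r :: "'a \<Rightarrow> nat" and e :: "'a \<Rightarrow> int"
  assumes "inj_on r A" "r ` A \<subseteq> {..<n}" "\<And>a. a \<in> A \<Longrightarrow> \<bar>e a\<bar> \<le> 1"
  shows "\<bar>\<Sum>a\<in>A. 2 ^ r a * e a\<bar> < 2 ^ n"
proof -
  have "\<bar>\<Sum>a\<in>A. 2 ^ r a * e a\<bar> \<le> (\<Sum>a\<in>A. \<bar>2 ^ r a * e a\<bar>)" by (rule sum_abs)
  also have "\<dots> \<le> (\<Sum>a\<in>A. 2 ^ r a)"
    using assms(3) by (intro sum_mono) (simp add: abs_mult mult_left_le)
  also have "\<dots> = (\<Sum>q\<in>r ` A. 2 ^ q)" using assms(1) by (simp add: sum.reindex)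
  also have "\<dots> \<le> (\<Sum>q\<in>{..<n}. 2 ^ q)" using assms(2) by (intro sum_mono2) auto
  also have "\<dots> = 2 ^ n - 1" by (simp add: mask_eq_sum_exp lessThan_def)
  finally show ?thesis by simp
qed

lemma sgn01_dominant_term:
  assumes "\<bar>s\<bar> < a" "e \<noteq> 0"
  shows "sgn01 (a * e + s) = sgn01 e"
proof (cases "e > 0")
  case True
  then have "a * 1 \<le> a * e" using assms(1) by (intro mult_left_mono) auto
  then show ?thesis using True assms(1) by (simp add: sgn01_def)
next
  case False
  then have "a * e \<le> a * (-1)" using assms by (intro mult_left_mono) auto
  then show ?thesis using False assms by (simp add: sgn01_def)
qed

lemma xy_fun_eq_sgn01_diff_form:
  assumes "z \<in> cube (xy_vars d k)"
  shows "xy_fun d k z = sgn01 (diff_form d k (\<lambda>\<alpha>. 2 ^ K_rank d k \<alpha>) z)"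
proof (cases "nonvanishing d k z = {}")
  case True
  then have "diff_form d k (\<lambda>\<alpha>. 2 ^ K_rank d k \<alpha>) z = 0"
    unfolding diff_form_def by (intro sum.neutral) (auto simp: nonvanishing_def)
  then show ?thesis using True by (simp add: xy_fun_def sgn01_def)
next
  case False
  let ?N = "nonvanishing d k z"
  have N: "?N \<subseteq> K d k" by (auto simp: nonvanishing_def)
  then obtain \<alpha> where \<alpha>: "is_largest d k ?N \<alpha>" using ex1_is_largest False by blast
  then have "\<alpha> \<in> ?N" by (simp add: is_largest_def)
  have "diff_form d k (\<lambda>\<alpha>. 2 ^ K_rank d k \<alpha>) z = (\<Sum>\<beta>\<in>?N. 2 ^ K_rank d k \<beta> * diff_prod d z \<beta>)"
    unfolding diff_form_def
    using N finite_K by (intro sum.mono_neutral_right) (auto simp: nonvanishing_def)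
  also have "\<dots> = 2 ^ K_rank d k \<alpha> * diff_prod d z \<alpha> +
      (\<Sum>\<beta>\<in>?N - {\<alpha>}. 2 ^ K_rank d k \<beta> * diff_prod d z \<beta>)"
    using finite_subset[OF N finite_K] \<open>\<alpha> \<in> ?N\<close> by (rule sum.remove)
  also have "sgn01 \<dots> = sgn01 (diff_prod d z \<alpha>)"
  proof (intro sgn01_dominant_term abs_sum_distinct_powers_less)
    show "inj_on (K_rank d k) (?N - {\<alpha>})"
      using N by (intro inj_on_subset[OF inj_on_K_rank]) auto
    show "K_rank d k ` (?N - {\<alpha>}) \<subseteq> {..<K_rank d k \<alpha>}"
      using \<alpha> N K_rank_less by (auto simp: is_largest_def subset_iff)
    show "\<bar>diff_prod d z \<beta>\<bar> \<le> 1" if "\<beta> \<in> ?N - {\<alpha>}" for \<beta>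
      using abs_diff_prod_le_1[OF assms] that N by blast
    show "diff_prod d z \<alpha> \<noteq> 0" using \<open>\<alpha> \<in> ?N\<close> by (simp add: nonvanishing_def)
  qed
  finally show ?thesis using xy_fun_is_largest[OF \<alpha>] by simp
qed

definition rank_gate :: "nat \<Rightarrow> (nat \<Rightarrow> nat) \<Rightarrow> xy_var int_mpoly" where
  "rank_gate d k = (\<Sum>\<alpha>\<in>K d k. Poly_Mapping.single 0 (2 ^ K_rank d k \<alpha>) *
     (\<Prod>i=1..d. mpoly_var (X i (\<alpha> i)) - mpoly_var (Y i (\<alpha> i))))"

lemma mpoly_eval_rank_gate:
  "mpoly_eval (rank_gate d k) z = diff_form d k (\<lambda>\<alpha>. 2 ^ K_rank d k \<alpha>) z"
  unfolding rank_gate_def diff_form_def diff_prod_def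
  by (simp add: mpoly_eval_sum mpoly_eval_mult mpoly_eval_prod mpoly_eval_diff mpoly_eval_var
      mpoly_eval_single monom_eval_def)

lemma rank_gate_in_mpolys: "rank_gate d k \<in> mpolys (xy_vars d k) d"
  unfolding rank_gate_def
proof (rule mpolys_sum)
  fix \<alpha> assume \<alpha>: "\<alpha> \<in> K d k"
  have "mpoly_var (X i (\<alpha> i)) - mpoly_var (Y i (\<alpha> i)) \<in> mpolys (xy_vars d k) 1"
    if "i \<in> {1..d}" for i
    using mem_K_imp_mem_xy_vars[OF \<alpha> that] by (intro mpolys_diff mpolys_var)
  then have "(\<Prod>i=1..d. mpoly_var (X i (\<alpha> i)) - mpoly_var (Y i (\<alpha> i)))
      \<in> mpolys (xy_vars d k) (\<Sum>i=1..d. 1)"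
    by (intro mpolys_prod) auto
  then show "Poly_Mapping.single 0 (2 ^ K_rank d k \<alpha>) *
      (\<Prod>i=1..d. mpoly_var (X i (\<alpha> i)) - mpoly_var (Y i (\<alpha> i))) \<in> mpolys (xy_vars d k) d"
    using mpolys_mult[OF mpolys_const] by fastforce
qed

lemma mpoly_degree_rank_gate: "mpoly_degree (rank_gate d k) \<le> d"
  using rank_gate_in_mpolys by (simp add: mpolys_def)

lemma threshold_gate_rank_gate: "threshold_gate (xy_vars d k) (xy_fun d k) (rank_gate d k)"
  using rank_gate_in_mpolys
  by (auto simp: threshold_gate_def mpolys_def mpoly_eval_rank_gate xy_fun_eq_sgn01_diff_form)


section \<open>The degree and weight of gates\<close>

lemma gate_degree_ge:
  assumes "K d k \<noteq> {}" "threshold_gate (xy_vars d k) (xy_fun d k) p"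
  shows "d \<le> mpoly_degree p"
proof (rule ccontr)
  assume "\<not> d \<le> mpoly_degree p"
  then have low: "mpoly_degree p < d" by simp
  have poly: "p \<in> mpolys (xy_vars d k) (mpoly_degree p)"
    using assms(2) by (simp add: threshold_gate_def mpolys_def)
  obtain \<beta> where \<beta>: "\<beta> \<in> K d k" using assms(1) by blast
  have "0 < antisymmetrize d (mpoly_eval p) (test_point d k \<beta> 1 {})"
    using low by (intro antisymmetrize_gate_test_point_pos assms(2) \<beta>) auto
  then show False using antisymmetrize_eq_0_if_degree_less[OF poly low test_point_in_cube] by simp
qed

lemma gate_weight_ge:
  assumes "d \<ge> 1" "K d k \<noteq> {}" "\<forall>i\<in>{1..<d}. even (k i)"
    and "threshold_gate (xy_vars d k) (xy_fun d k) p" "mpoly_degree p \<le> d"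
  shows "2 ^ ((k d - 2) * (\<Prod>i=1..<d. k i)) \<le> 2 ^ d * mpoly_weight p"
proof -
  obtain c where c: "dominating d k c" "\<And>\<beta>. \<beta> \<in> K d k \<Longrightarrow> c \<beta> \<le> 2 ^ d * int (mpoly_weight p)"
    using gate_coefficients[OF assms(1,4,5)] by blast
  obtain \<alpha> where \<alpha>: "\<alpha> \<in> K d k" using assms(2) by blast
  have "1 \<le> k 1" using \<alpha> assms(1) by (intro mem_K_imp_length_pos) auto
  then have first_last: "cell_elem d k 1 \<alpha> 1 \<in> K d k" "cell_elem d k 1 \<alpha> (k 1) \<in> K d k"
    using \<alpha> assms(1) by (auto intro: cell_elem_in_K)
  let ?E = "(k d - 2) * (\<Prod>i=1..<d. k i)"
  have "(2::int) ^ ?E * 1 \<le> 2 ^ ?E * c (cell_elem d k 1 \<alpha> 1)"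
    using dominating_pos[OF c(1) assms(1) first_last(1)] by (intro mult_left_mono) auto
  also have "\<dots> \<le> c (cell_elem d k 1 \<alpha> (k 1))"
    using c(1) assms(1,3) \<alpha> by (intro dominating_cell_growth) auto
  also have "\<dots> \<le> 2 ^ d * int (mpoly_weight p)" using first_last(2) by (rule c(2))
  finally have "int (2 ^ ?E) \<le> int (2 ^ d * mpoly_weight p)" by simp
  then show ?thesis by (simp only: of_nat_le_iff)
qed

lemma threshold_degree_xy_fun:
  assumes "K d k \<noteq> {}"
  shows "threshold_degree (xy_vars d k) (xy_fun d k) = d"
  using threshold_gate_rank_gate mpoly_degree_rank_gate gate_degree_ge[OF assms]
  by (rule threshold_degree_eqI)

lemma threshold_weight_xy_fun_ge:
  assumes "d \<ge> 1" "K d k \<noteq> {}" "\<forall>i\<in>{1..<d}. even (k i)"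
  shows "2 ^ ((k d - 2) * (\<Prod>i=1..<d. k i)) \<le> 2 ^ d * threshold_weight (xy_vars d k) (xy_fun d k) d"
proof -
  obtain q where "threshold_gate (xy_vars d k) (xy_fun d k) q" "mpoly_degree q \<le> d"
      "mpoly_weight q = threshold_weight (xy_vars d k) (xy_fun d k) d"
    using threshold_gate_rank_gate mpoly_degree_rank_gate by (rule threshold_weight_attained)
  then show ?thesis using gate_weight_ge[OF assms] by metis
qed

theorem theorem3p2:
  fixes d :: nat and k :: "nat \<Rightarrow> nat"
  assumes "d \<ge> 1"
    and "\<forall>i\<in>{1..<d}. k i \<ge> 2 \<and> even (k i)"
    and "k d \<ge> 3"
  shows "threshold_degree (xy_vars d k) (xy_fun d k) = d \<and>
    real (threshold_weight (xy_vars d k) (xy_fun d k) d)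
      \<ge> 2 powr ((real (k d) - 2) * (\<Prod>i\<in>{1..<d}. real (k i)) - real d)"
proof
  let ?W = "threshold_weight (xy_vars d k) (xy_fun d k) d"
  let ?E = "(k d - 2) * (\<Prod>i=1..<d. k i)"
  have "1 \<le> k i" if "i \<in> {1..d}" for i using assms that by (cases "i = d") force+
  then have nonempty: "K d k \<noteq> {}" by (auto simp: K_def PiE_eq_empty_iff)
  then show "threshold_degree (xy_vars d k) (xy_fun d k) = d" by (rule threshold_degree_xy_fun)
  have "2 ^ ?E \<le> 2 ^ d * ?W"
    using assms(1) nonempty assms(2) by (intro threshold_weight_xy_fun_ge) auto
  then have "real (2 ^ ?E) \<le> real (2 ^ d * ?W)" by (simp only: of_nat_le_iff)
  then have "2 ^ ?E / 2 ^ d \<le> real ?W" by (simp add: field_simps)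
  then have "2 powr (real ?E - real d) \<le> real ?W"
    unfolding powr_diff by (simp only: powr_realpow zero_less_numeral)
  moreover have "real ?E = (real (k d) - 2) * (\<Prod>i\<in>{1..<d}. real (k i))" using assms(3) by simp
  ultimately show "2 powr ((real (k d) - 2) * (\<Prod>i\<in>{1..<d}. real (k i)) - real d) \<le> real ?W"
    by (simp only:)
qed

end
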